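(* Let $n\ge 2$ and let $k$ be a positive integer. Given any $C^{k+2}$ function $\varphi:(0,\infty)\to\mathbb{R}$ satisfying $$\lim_{s\to\infty}\varphi(s)=\infty,\qquad \lim_{s\to\infty}\varphi'(s)=\cdots=\lim_{s\to\infty}\varphi^{(k+2)}(s)=0,$$ there is a function $u:\mathbb{R}^n\to\mathbb{R}$, depending on $\varphi$, with compact support, such that $u$ is $(k+2)$-times differentiable everywhere in $\mathbb{R}^n$, $\Delta u$ is $C^k$ on $\mathbb{R}^n$, but $D^{k+2}u$ is unbounded. In particular, $u\notin C^{k+2}(\mathbb{R}^n)$.
   Context: $(k+2)$-times differentiable at a point means that all partial derivatives of order at most $k+1$ exist in a neighbourhood of the point and are (Fréchet) differentiable at that point. $D^{k+2}u$ is the collection of all partial derivatives of $u$ of order $k+2$; it is unbounded if at least one of them is an unbounded function. $\Delta$ is the Laplacian. *)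

theory Defs
  imports "HOL-Analysis.Analysis"
begin

definition has_partial_at :: "'n::finite \<Rightarrow> (real ^ 'n \<Rightarrow> real) \<Rightarrow> real ^ 'n \<Rightarrow> bool" where
  "has_partial_at i f x \<longleftrightarrow> (\<lambda>t. f (x + t *\<^sub>R axis i 1)) differentiable (at 0)"

definition partial :: "'n::finite \<Rightarrow> (real ^ 'n \<Rightarrow> real) \<Rightarrow> real ^ 'n \<Rightarrow> real" where
  "partial i f x = deriv (\<lambda>t. f (x + t *\<^sub>R axis i 1)) 0"

text \<open>An iterated partial derivative is indexed by the list of the directions of differentiation,
  the last element being applied first; its order is the length of the list. No symmetry in
  the order of differentiation is presupposed. Like \<^const>\<open>deriv\<close>, it is a total function whose
  value is arbitrary where the derivative does not exist; existence is tracked separately by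
  \<open>partials_exist_on\<close>.\<close>

fun iter_partial :: "'n::finite list \<Rightarrow> (real ^ 'n \<Rightarrow> real) \<Rightarrow> real ^ 'n \<Rightarrow> real" where
  "iter_partial [] f = f"
| "iter_partial (i # is) f = partial i (iter_partial is f)"

text \<open>All partial derivatives of order at most \<open>m\<close> exist at all points of the set \<open>U\<close>
  (which is always open below).\<close>

definition partials_exist_on :: "nat \<Rightarrow> (real ^ 'n::finite \<Rightarrow> real) \<Rightarrow> (real ^ 'n) set \<Rightarrow> bool" where
  "partials_exist_on m f U \<longleftrightarrow>
     (\<forall>is. length is < m \<longrightarrow> (\<forall>i. \<forall>x\<in>U. has_partial_at i (iter_partial is f) x))"

definition times_differentiable_at ::
    "nat \<Rightarrow> (real ^ 'n::finite \<Rightarrow> real) \<Rightarrow> real ^ 'n \<Rightarrow> bool" where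
  "times_differentiable_at m f x \<longleftrightarrow>
     (\<exists>U. open U \<and> x \<in> U \<and> partials_exist_on (m - 1) f U) \<and>
     (\<forall>is. length is < m \<longrightarrow> iter_partial is f differentiable (at x))"

definition C_k :: "nat \<Rightarrow> (real ^ 'n::finite \<Rightarrow> real) \<Rightarrow> bool" where
  "C_k m f \<longleftrightarrow> partials_exist_on m f UNIV \<and>
     (\<forall>is. length is \<le> m \<longrightarrow> continuous_on UNIV (iter_partial is f))"

definition laplacian :: "(real ^ 'n::finite \<Rightarrow> real) \<Rightarrow> real ^ 'n \<Rightarrow> real" where
  "laplacian f x = (\<Sum>i\<in>UNIV. iter_partial [i, i] f x)"

definition compactly_supported :: "(real ^ 'n::finite \<Rightarrow> real) \<Rightarrow> bool" where
  "compactly_supported f \<longleftrightarrow> compact (closure {x. f x \<noteq> 0})"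

text \<open>\<open>D\<^sup>m f\<close> is unbounded: some partial derivative of order \<open>m\<close> is an unbounded function.\<close>

definition unbounded_partials :: "nat \<Rightarrow> (real ^ 'n::finite \<Rightarrow> real) \<Rightarrow> bool" where
  "unbounded_partials m f \<longleftrightarrow> (\<exists>is. length is = m \<and> \<not> bounded (range (iter_partial is f)))"

text \<open>A function on \<open>(0,\<infinity>)\<close> is represented by a function on all reals; only its values at positive
  arguments matter, since derivatives at positive points are local.\<close>

definition C_k_pos :: "nat \<Rightarrow> (real \<Rightarrow> real) \<Rightarrow> bool" where
  "C_k_pos m \<phi> \<longleftrightarrow>
     (\<forall>j<m. \<forall>s>0. (deriv ^^ j) \<phi> differentiable (at s)) \<and>
     (\<forall>j\<le>m. continuous_on {0<..} ((deriv ^^ j) \<phi>))"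

end

(* The homogeneous harmonic polynomial P = Re ((x_p + i x_q)^(k+2)) is multiplied by a cutoff of
   e ln |x|^2 with a small slope e. Since P is harmonic and of degree k+2, every derivative of order
   at most k of the Laplacian of the product is O(e), while its derivatives of order k+2 at the centre
   are those of P, and those of lower order are small when the support is small. The function u is the
   sum of such bumps with amplitudes j+1, slopes and radii tending rapidly to 0, and disjoint supports
   accumulating at the origin. Near every other point u is a single bump; at the origin all derivatives
   of u of order at most k+1, and all those of its Laplacian of order at most k, are O(|x|^2), hence
   differentiable there. *)
theory Submission
  imports Defs
begin

text \<open>P has degree k + 2, so k + 2 derivatives leave no power of the scale. With a cutoff
  depending on |x|/r alone, the derivatives of order k of the Laplacian of the product would
  therefore keep the same supremum however small r is, and growing amplitudes could not be absorbed.
  The logarithm breaks this scale invariance: the cutoff falls from 1 to 0 while ln |x|^2 runs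
  through a range of length about 1/e, so every derivative of it has the homogeneity of the
  corresponding power of |x| and carries a factor e in addition. Amplitude times slope can then tend
  to 0 while the amplitude itself tends to infinity. The bounds at the origin are required to be
  quadratic, not merely small, because a quadratic bound forces the gradient there to vanish; this
  is the information needed for the derivative of the next order.\<close>

section \<open>A smooth cutoff on the real line with bounded derivatives of all orders\<close>

text \<open>Differentiating exp(-1/x) produces powers of 1/x; the polynomial factor in 1/x collects
  them.\<close>

definition flat :: "real poly \<Rightarrow> real \<Rightarrow> real" where
  "flat P x = (if x > 0 then poly P (1 / x) * exp (- (1 / x)) else 0)"

lemma tendsto_poly_div_exp:
  fixes P :: "real poly"
  shows "((\<lambda>y. poly P y / exp y) \<longlongrightarrow> 0) at_top"
proof -
  have "((\<lambda>y. \<Sum>i\<le>degree P. coeff P i * (y ^ i / exp y)) \<longlongrightarrow> (\<Sum>i\<le>degree P. coeff P i * 0)) at_top"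
    by (intro tendsto_intros tendsto_power_div_exp_0)
  then show ?thesis
    by (simp add: poly_altdef sum_divide_distrib)
qed

lemma tendsto_flat_0: "(flat P \<longlongrightarrow> 0) (at 0)"
proof -
  have "((\<lambda>x::real. poly P (inverse x) / exp (inverse x)) \<longlongrightarrow> 0) (at_right 0)"
    by (rule filterlim_compose[OF tendsto_poly_div_exp filterlim_inverse_at_top_right])
  then have "(flat P \<longlongrightarrow> 0) (at_right 0)"
    by (rule Lim_transform_eventually)
       (auto simp: flat_def eventually_at_filter exp_minus field_simps)
  moreover have "(flat P \<longlongrightarrow> 0) (at_left 0)"
    by (rule Lim_transform_eventually[OF tendsto_const])
       (auto simp: flat_def eventually_at_filter)
  ultimately show ?thesis
    by (simp add: filterlim_split_at)
qed

text \<open>With y = 1/x one has dy/dx = -y^2, so P(y) exp(-y) has derivative y^2 (P - P')(y)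
  exp(-y), and \<open>[:0, 0, 1:]\<close> is y^2. At 0 the difference quotient is the flat function
  of y P(y), which tends to 0.\<close>

lemma flat_has_derivative:
  "(flat P has_real_derivative flat ([:0, 0, 1:] * (P - pderiv P)) x) (at x)"
proof (cases "x = 0")
  case True
  have "flat P h / h = flat ([:0, 1:] * P) h" for h
    by (auto simp: flat_def)
  then have "((\<lambda>h. (flat P (0 + h) - flat P 0) / h) \<longlongrightarrow> 0) (at 0)"
    using tendsto_flat_0[of "[:0, 1:] * P"] by (simp add: flat_def[of _ 0])
  then show ?thesis
    using True by (simp add: DERIV_def flat_def[of _ 0])
next
  case False
  show ?thesis
  proof (cases "x > 0")
    case True
    have "((\<lambda>x. poly P (1 / x) * exp (- (1 / x))) has_real_derivative
        flat ([:0, 0, 1:] * (P - pderiv P)) x) (at x)"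
      using True
      by (auto intro!: derivative_eq_intros DERIV_chain2[OF poly_DERIV]
          simp: flat_def field_simps power2_eq_square)
    then show ?thesis
      using True
      by (elim DERIV_cong_ev[THEN iffD1, OF refl _ refl, rotated])
         (auto simp: flat_def eventually_nhds intro!: exI[of _ "{0<..}"])
  next
    case neg: False
    have "((\<lambda>x. 0) has_real_derivative flat ([:0, 0, 1:] * (P - pderiv P)) x) (at x)"
      using neg by (simp add: flat_def)
    then show ?thesis
      using neg False
      by (elim DERIV_cong_ev[THEN iffD1, OF refl _ refl, rotated])
         (auto simp: flat_def eventually_nhds intro!: exI[of _ "{..<0}"])
  qed
qed

text \<open>The class is closed under differentiation, and its members are supported in \<open>[0, 1]\<close>, hence
  bounded: this yields a cutoff with bounded derivatives of all orders.\<close>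

inductive bump_class :: "(real \<Rightarrow> real) \<Rightarrow> bool" where
  product: "bump_class (\<lambda>x. flat P x * flat Q (1 - x))"
| diff: "bump_class f \<Longrightarrow> bump_class g \<Longrightarrow> bump_class (\<lambda>x. f x - g x)"

lemma bump_class_deriv:
  "bump_class f \<Longrightarrow> \<exists>f'. bump_class f' \<and> (\<forall>x. (f has_real_derivative f' x) (at x))"
proof (induction rule: bump_class.induct)
  case (product P Q)
  define D where "D P = [:0, 0, 1:] * (P - pderiv P)" for P :: "real poly"
  \<comment> \<open>The reflection x -> 1 - x contributes a minus sign, which is why
    \<open>bump_class\<close> is closed under differences.\<close>
  have *: "((\<lambda>x. flat Q (1 - x)) has_real_derivative - flat (D Q) (1 - x)) (at x)" for x
  proof -
    have "((\<lambda>x. 1 - x) has_real_derivative - 1) (at x)"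
      by (auto intro!: derivative_eq_intros)
    from DERIV_chain2[OF flat_has_derivative this] show ?thesis
      by (simp add: D_def)
  qed
  have "((\<lambda>x. flat P x * flat Q (1 - x)) has_real_derivative
      flat (D P) x * flat Q (1 - x) - flat P x * flat (D Q) (1 - x)) (at x)" for x
    using DERIV_mult[OF flat_has_derivative[of P x] *[of x]] by (simp only: D_def) (simp add: mult.commute)
  then show ?case
    by (intro exI[where x = "\<lambda>x. flat (D P) x * flat Q (1 - x) - flat P x * flat (D Q) (1 - x)"]
        conjI allI bump_class.intros)
next
  case (diff f g)
  then obtain f' g' where "bump_class f'" "bump_class g'"
    and "\<forall>x. (f has_real_derivative f' x) (at x)" "\<forall>x. (g has_real_derivative g' x) (at x)"
    by blast
  then show ?case
    by (intro exI[where x = "\<lambda>x. f' x - g' x"] conjI allI bump_class.diff DERIV_diff) auto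
qed

lemma bump_class_zero: "bump_class f \<Longrightarrow> x \<le> 0 \<or> x \<ge> 1 \<Longrightarrow> f x = 0"
  by (induction rule: bump_class.induct) (auto simp: flat_def)

lemma bump_class_bounded:
  assumes "bump_class f"
  shows "bounded (range f)"
proof -
  have "continuous_on {0..1} f"
    using bump_class_deriv[OF assms]
    by (meson DERIV_isCont continuous_at_imp_continuous_on)
  then have "bounded (f ` {0..1})"
    by (intro compact_imp_bounded compact_continuous_image) auto
  moreover have "range f \<subseteq> insert 0 (f ` {0..1})"
  proof
    fix y assume "y \<in> range f"
    then obtain x where "y = f x" by auto
    then show "y \<in> insert 0 (f ` {0..1})"
      using bump_class_zero[OF assms, of x] by (cases "x \<in> {0..1}") auto
  qed
  ultimately show ?thesis
    by (metis bounded_insert bounded_subset)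
qed

text \<open>Membership in such a set says "smooth with all derivatives bounded" without iterated
  derivatives: later arguments only pass from a member to a derivative that is again a
  member.\<close>

definition diff_closed :: "(real \<Rightarrow> real) set \<Rightarrow> bool" where
  "diff_closed S \<longleftrightarrow>
     (\<forall>f\<in>S. bounded (range f) \<and> (\<exists>f'\<in>S. \<forall>x. (f has_real_derivative f' x) (at x)))"

text \<open>The cutoff is a normalised antiderivative of a bump supported in [0, 1], hence constant
  on either side of that interval.\<close>

lemma smooth_cutoff_exists:
  obtains S \<eta> where "diff_closed S" "\<eta> \<in> S" "\<And>s. s \<le> 0 \<Longrightarrow> \<eta> s = 1" "\<And>s. s \<ge> 1 \<Longrightarrow> \<eta> s = 0"
proof -
  define g where "g = (\<lambda>x. flat 1 x * flat 1 (1 - x))"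
  have g: "bump_class g"
    unfolding g_def by (rule bump_class.product)
  have gcont: "isCont g x" for x
    using bump_class_deriv[OF g] DERIV_isCont by blast
  obtain F where "\<forall>x. - \<infinity> < ereal x \<longrightarrow> ereal x < \<infinity> \<longrightarrow> (F has_vector_derivative g x) (at x)"
    using einterval_antiderivative[of "-\<infinity>" \<infinity> g] gcont by auto
  then have F: "(F has_real_derivative g x) (at x)" for x
    by (simp add: has_real_derivative_iff_has_vector_derivative)
  have low: "F s = F 0" if "s \<le> 0" for s
  proof (cases "s = 0")
    case False
    then have "s < 0"
      using that by simp
    obtain z where "s < z" "z < 0" "F 0 - F s = (0 - s) * g z"
      using MVT2[OF \<open>s < 0\<close> F] by blast
    then show ?thesis
      using bump_class_zero[OF g, of z] by simp
  qed simp
  have high: "F s = F 1" if "s \<ge> 1" for s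
  proof (cases "s = 1")
    case False
    then have "1 < s"
      using that by simp
    obtain z where "1 < z" "z < s" "F s - F 1 = (s - 1) * g z"
      using MVT2[OF \<open>1 < s\<close> F] by blast
    then show ?thesis
      using bump_class_zero[OF g, of z] by simp
  qed simp
  have "F 0 < F 1"
  proof -
    obtain z where "0 < z" "z < 1" "F 1 - F 0 = (1 - 0) * g z"
      using MVT2[OF zero_less_one F] by blast
    moreover have "0 < g z"
      using \<open>0 < z\<close> \<open>z < 1\<close> by (simp add: g_def flat_def)
    ultimately show ?thesis
      by simp
  qed
  define I where "I = F 1 - F 0"
  have I: "I > 0"
    using \<open>F 0 < F 1\<close> by (simp add: I_def)
  define \<eta> where "\<eta> s = (F 1 - F s) / I" for s
  \<comment> \<open>The derivative -g / I of the cutoff; the constant sits inside the polynomial so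
    that \<open>h\<close> is literally of the form \<open>product\<close>.\<close>
  define h where "h = (\<lambda>x. flat [:- 1 / I:] x * flat 1 (1 - x))"
  have h: "bump_class h"
    unfolding h_def by (rule bump_class.product)
  have \<eta>': "(\<eta> has_real_derivative h x) (at x)" for x
    unfolding \<eta>_def using I
    by (auto intro!: derivative_eq_intros F simp: h_def g_def flat_def)
  have "continuous_on {0..1} \<eta>"
    using DERIV_isCont[OF \<eta>'] by (intro continuous_at_imp_continuous_on ballI)
  then have "bounded (\<eta> ` {0..1})"
    by (intro compact_imp_bounded compact_continuous_image) auto
  moreover have \<eta>1: "\<eta> s = 1" if "s \<le> 0" for s
    using low[OF that] I by (simp add: \<eta>_def I_def)
  moreover have \<eta>0: "\<eta> s = 0" if "s \<ge> 1" for s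
    using high[OF that] I by (simp add: \<eta>_def)
  moreover have "range \<eta> \<subseteq> insert 0 (insert 1 (\<eta> ` {0..1}))"
  proof
    fix y assume "y \<in> range \<eta>"
    then obtain x where "y = \<eta> x" by auto
    then show "y \<in> insert 0 (insert 1 (\<eta> ` {0..1}))"
      using \<eta>1[of x] \<eta>0[of x] by (cases "x \<in> {0..1}") auto
  qed
  ultimately have "bounded (range \<eta>)"
    using bounded_subset by (metis bounded_insert)
  \<comment> \<open>Functions in \<open>bump_class\<close> vanish on the negative axis, where the
    cutoff is 1, so it has to be added to the class.\<close>
  then have "diff_closed (insert \<eta> {f. bump_class f})"
    unfolding diff_closed_def
    using \<eta>' h bump_class_bounded bump_class_deriv by blast
  then show ?thesis
    using that \<eta>1 \<eta>0 by blast
qed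

section \<open>Partial derivatives: Frechet derivative, locality, translation and scaling\<close>

lemma has_derivative_along_axis:
  fixes f :: "real ^ 'n::finite \<Rightarrow> real"
  assumes "(f has_derivative f') (at x)"
  shows "((\<lambda>t. f (x + t *\<^sub>R axis i 1)) has_real_derivative f' (axis i 1)) (at 0)"
proof -
  have "((\<lambda>t. x + t *\<^sub>R axis i 1) has_derivative (\<lambda>t. t *\<^sub>R axis i 1)) (at 0)"
    by (auto intro!: derivative_eq_intros)
  moreover have "(f has_derivative f') (at (x + 0 *\<^sub>R axis i 1))"
    using assms by simp
  ultimately have "((\<lambda>t. f (x + t *\<^sub>R axis i 1)) has_derivative (\<lambda>t. f' (t *\<^sub>R axis i 1))) (at 0)"
    by (rule has_derivative_compose)
  moreover have "f' (t *\<^sub>R axis i 1) = f' (axis i 1) * t" for t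
    using linear_scale[OF has_derivative_linear[OF assms]] by simp
  ultimately show ?thesis
    by (simp add: has_field_derivative_def)
qed

lemma partial_eq:
  fixes f :: "real ^ 'n::finite \<Rightarrow> real"
  assumes "(f has_derivative f') (at x)"
  shows "partial i f x = f' (axis i 1)"
  using DERIV_imp_deriv[OF has_derivative_along_axis[OF assms]] by (simp add: partial_def)

lemma differentiable_imp_has_partial_at:
  fixes f :: "real ^ 'n::finite \<Rightarrow> real"
  assumes "f differentiable (at x)"
  shows "has_partial_at i f x"
  using assms has_derivative_along_axis
  unfolding has_partial_at_def differentiable_def has_field_derivative_def by blast

lemma partial_cong_open:
  assumes "open U" "x \<in> U" "\<And>y. y \<in> U \<Longrightarrow> f y = g y"
  shows "partial i f x = partial i g x"
proof -
  have "((\<lambda>t. x + t *\<^sub>R axis i 1) \<longlongrightarrow> x + 0 *\<^sub>R axis i 1) (nhds 0)"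
    by (intro tendsto_intros filterlim_ident)
  then have "eventually (\<lambda>t::real. x + t *\<^sub>R axis i 1 \<in> U) (nhds 0)"
    using assms(1,2) by (auto dest: topological_tendstoD)
  then have "eventually (\<lambda>t. f (x + t *\<^sub>R axis i 1) = g (x + t *\<^sub>R axis i 1)) (nhds 0)"
    by eventually_elim (rule assms(3))
  then show ?thesis
    unfolding partial_def by (rule deriv_cong_ev) simp
qed

text \<open>Only germs matter, so the equality holds even where the derivatives fail to exist.
  Openness lets the induction hypothesis be used at all points near x.\<close>

lemma iter_partial_cong_open:
  assumes "open U" "\<And>y. y \<in> U \<Longrightarrow> f y = g y" "x \<in> U"
  shows "iter_partial is f x = iter_partial is g x"
  using assms(3)
proof (induction "is" arbitrary: x)
  case (Cons i "is")
  then show ?case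
    using partial_cong_open[OF assms(1), of x "iter_partial is f"] by simp
qed (simp add: assms(2))

lemma partial_zero [simp]: "partial i (\<lambda>x. 0) = (\<lambda>x. 0)"
  by (simp add: partial_def fun_eq_iff)

lemma iter_partial_zero [simp]: "iter_partial is (\<lambda>x. 0) = (\<lambda>x. 0)"
  by (induction "is") auto

lemma laplacian_cong_open:
  assumes "open U" "\<And>y. y \<in> U \<Longrightarrow> f y = g y" "x \<in> U"
  shows "laplacian f x = laplacian g x"
  unfolding laplacian_def by (intro sum.cong refl iter_partial_cong_open[OF assms])

definition smooth_fun :: "(real ^ 'n::finite \<Rightarrow> real) \<Rightarrow> bool" where
  "smooth_fun f \<longleftrightarrow> (\<forall>is x. iter_partial is f differentiable (at x))"

lemma partial_affine:
  fixes f :: "real ^ 'n::finite \<Rightarrow> real" and c :: real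
  assumes "\<And>x. f differentiable (at x)"
  shows "(\<lambda>x. c * f (x - a)) differentiable (at x)"
    and "partial i (\<lambda>x. c * f (x - a)) x = c * partial i f (x - a)"
proof -
  obtain f' where f': "(f has_derivative f') (at (x - a))"
    using assms unfolding differentiable_def by blast
  have "((\<lambda>x. x - a) has_derivative (\<lambda>h. h)) (at x)"
    by (auto intro!: derivative_eq_intros)
  from has_derivative_mult_right[OF has_derivative_compose[OF this f']]
  have *: "((\<lambda>x. c * f (x - a)) has_derivative (\<lambda>h. c * f' h)) (at x)" .
  then show "(\<lambda>x. c * f (x - a)) differentiable (at x)"
    unfolding differentiable_def by blast
  show "partial i (\<lambda>x. c * f (x - a)) x = c * partial i f (x - a)"
    by (simp add: partial_eq[OF *] partial_eq[OF f'])
qed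

lemma iter_partial_affine:
  fixes f :: "real ^ 'n::finite \<Rightarrow> real" and c :: real
  assumes "smooth_fun f"
  shows "iter_partial is (\<lambda>x. c * f (x - a)) = (\<lambda>x. c * iter_partial is f (x - a))"
proof (induction "is")
  case (Cons i "is")
  show ?case
    unfolding iter_partial.simps Cons.IH
    using assms unfolding smooth_fun_def by (intro ext partial_affine(2)) blast
qed simp

lemma smooth_fun_affine:
  fixes f :: "real ^ 'n::finite \<Rightarrow> real" and c :: real
  assumes "smooth_fun f"
  shows "smooth_fun (\<lambda>x. c * f (x - a))"
  unfolding smooth_fun_def iter_partial_affine[OF assms]
  using assms unfolding smooth_fun_def by (intro allI partial_affine(1)) blast

lemma laplacian_affine:
  fixes f :: "real ^ 'n::finite \<Rightarrow> real" and c :: real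
  assumes "smooth_fun f"
  shows "laplacian (\<lambda>x. c * f (x - a)) = (\<lambda>x. c * laplacian f (x - a))"
  unfolding laplacian_def iter_partial_affine[OF assms] by (simp only: sum_distrib_left)

section \<open>Differentiability at the point where the bumps accumulate\<close>

lemma has_derivative_zero_of_square_bound:
  fixes f :: "'a::real_normed_vector \<Rightarrow> real"
  assumes "\<And>x. \<bar>f x\<bar> \<le> C * (norm x)\<^sup>2"
  shows "(f has_derivative (\<lambda>h. 0)) (at 0)"
proof -
  have "((\<lambda>h. norm (f h) / norm h) \<longlongrightarrow> 0) (at 0)"
  proof (rule Lim_null_comparison)
    show "eventually (\<lambda>h. norm (norm (f h) / norm h) \<le> C * norm h) (at 0)"
      using assms by (auto simp: eventually_at_filter divide_le_eq power2_eq_square mult.assoc)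
    show "((\<lambda>h. C * norm h) \<longlongrightarrow> 0) (at (0::'a))"
      by (auto intro!: tendsto_eq_intros)
  qed
  moreover have "f 0 = 0"
    using assms[of 0] by simp
  ultimately show ?thesis
    by (simp add: has_derivative_at)
qed

text \<open>Away from 0 everything is inherited from some \<open>W j\<close>, and the constant is
  uniform in j because j varies as x tends to 0. At 0 one climbs through the orders: a derivative
  that vanishes at 0 satisfies the quadratic bound everywhere, hence has zero gradient at 0, so the
  derivatives of the next order vanish there too.\<close>

lemma iter_partial_differentiable_of_local:
  fixes f :: "real ^ 'n::finite \<Rightarrow> real"
  assumes W: "\<And>j. smooth_fun (W j)"
    and loc: "\<And>x. x \<noteq> 0 \<Longrightarrow> \<exists>j U. open U \<and> x \<in> U \<and> (\<forall>y\<in>U. f y = W j y)"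
    and f0: "f 0 = 0"
    and bound: "\<And>is. length is \<le> M \<Longrightarrow> \<exists>C. \<forall>j x. \<bar>iter_partial is (W j) x\<bar> \<le> C * (norm x)\<^sup>2"
    and len: "length is \<le> M"
  shows "iter_partial is f differentiable (at x)" and "iter_partial is f 0 = 0"
proof -
  have sq: "\<exists>C. \<forall>x. \<bar>iter_partial is f x\<bar> \<le> C * (norm x)\<^sup>2"
    if len': "length is \<le> M" and zero: "iter_partial is f 0 = 0" for "is"
  proof -
    obtain C where C: "\<And>j x. \<bar>iter_partial is (W j) x\<bar> \<le> C * (norm x)\<^sup>2"
      using bound[OF len'] by blast
    have "\<bar>iter_partial is f x\<bar> \<le> C * (norm x)\<^sup>2" for x
    proof (cases "x = 0")
      case False
      then obtain j U where "open U" "x \<in> U" "\<forall>y\<in>U. f y = W j y"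
        using loc by blast
      then show ?thesis
        using iter_partial_cong_open[of U f "W j" x "is"] C by simp
    qed (simp add: zero)
    then show ?thesis by blast
  qed
  have at0: "length is \<le> M \<Longrightarrow> iter_partial is f 0 = 0" for "is"
  proof (induction "is")
    case (Cons i "is")
    then obtain C where "\<And>x. \<bar>iter_partial is f x\<bar> \<le> C * (norm x)\<^sup>2"
      using sq[of "is"] by auto
    from has_derivative_zero_of_square_bound[OF this] show ?case
      by (simp add: partial_eq)
  qed (simp add: f0)
  then show "iter_partial is f 0 = 0"
    using len by blast
  show "iter_partial is f differentiable (at x)"
  proof (cases "x = 0")
    case True
    obtain C where "\<And>x. \<bar>iter_partial is f x\<bar> \<le> C * (norm x)\<^sup>2"
      using sq[OF len at0[OF len]] by blast
    from has_derivative_zero_of_square_bound[OF this] show ?thesis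
      using True differentiableI by blast
  next
    case False
    then obtain j U where U: "open U" "x \<in> U" "\<forall>y\<in>U. f y = W j y"
      using loc by blast
    have "iter_partial is (W j) differentiable (at x)"
      using W by (simp add: smooth_fun_def)
    then obtain D where "(iter_partial is (W j) has_derivative D) (at x)"
      unfolding differentiable_def by blast
    moreover have "iter_partial is (W j) y = iter_partial is f y" if "y \<in> U" for y
      using iter_partial_cong_open[OF U(1) _ that] U(3) by metis
    ultimately have "(iter_partial is f has_derivative D) (at x)"
      using has_derivative_transform_within_open[OF _ U(1,2)] by blast
    then show ?thesis
      using differentiableI by blast
  qed
qed

section \<open>Calculus of weighted families, uniform in the parameters\<close>

text \<open>A parameter triple \<open>(e, b, d)\<close> selects the cutoff \<open>\<eta> (e ln (|x|\<^sup>2 + d) + b)\<close>; the shift \<open>d > 0\<close>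
  removes the singularity of the logarithm at the origin.\<close>

type_synonym params = "real \<times> real \<times> real"

definition rho :: "params \<Rightarrow> real ^ 'n::finite \<Rightarrow> real" where
  "rho = (\<lambda>(e, b, d) x. x \<bullet> x + d)"

definition phase :: "params \<Rightarrow> real ^ 'n::finite \<Rightarrow> real" where
  "phase = (\<lambda>(e, b, d) x. e * ln (x \<bullet> x + d) + b)"

definition planar :: "'n::finite \<Rightarrow> 'n \<Rightarrow> real ^ 'n \<Rightarrow> complex" where
  "planar p q x = Complex (x $ p) (x $ q)"

text \<open>The bound on e makes the factor e itself a family of weight 0. The offset b is
  unrestricted: it enters only through bounded functions of the phase, and it will be unbounded as
  the radius tends to 0.\<close>

definition admissible :: "params \<Rightarrow> bool" where
  "admissible = (\<lambda>(e, b, d). 0 < e \<and> e \<le> 1 \<and> 0 < d)"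

text \<open>Families of weight \<open>w\<close> are \<open>O((|x|\<^sup>2 + d)\<^bsup>w/2\<^esup>)\<close> uniformly in all parameters with \<open>e \<le> 1\<close>, and a
  partial derivative lowers the weight by one. Counting weights replaces every explicit
  computation of higher derivatives.\<close>

inductive weighted ::
    "(real \<Rightarrow> real) set \<Rightarrow> 'n \<Rightarrow> 'n \<Rightarrow> int \<Rightarrow> (params \<Rightarrow> real ^ 'n::finite \<Rightarrow> real) \<Rightarrow> bool"
  for S p q where
  zero: "weighted S p q w (\<lambda>\<theta> x. 0)"
| const: "weighted S p q 0 (\<lambda>\<theta> x. c)"
| eps: "weighted S p q 0 (\<lambda>\<theta> x. fst \<theta>)"
| coord: "weighted S p q 1 (\<lambda>\<theta> x. x $ i)"
| harmonic: "weighted S p q (int l) (\<lambda>\<theta> x. Re (c * planar p q x ^ l))"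
| inverse_rho: "weighted S p q (- 2) (\<lambda>\<theta> x. 1 / rho \<theta> x)"
| cutoff: "h \<in> S \<Longrightarrow> weighted S p q 0 (\<lambda>\<theta> x. h (phase \<theta> x))"
| add: "weighted S p q w F \<Longrightarrow> weighted S p q w G \<Longrightarrow> weighted S p q w (\<lambda>\<theta> x. F \<theta> x + G \<theta> x)"
| mult: "weighted S p q w F \<Longrightarrow> weighted S p q w' G \<Longrightarrow>
    weighted S p q (w + w') (\<lambda>\<theta> x. F \<theta> x * G \<theta> x)"

lemma weighted_sum:
  "finite A \<Longrightarrow> (\<And>i. i \<in> A \<Longrightarrow> weighted S p q w (F i)) \<Longrightarrow>
    weighted S p q w (\<lambda>\<theta> x. \<Sum>i\<in>A. F i \<theta> x)"
  by (induction A rule: finite_induct) (auto intro: weighted.zero weighted.add)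

lemma rho_pos: "admissible \<theta> \<Longrightarrow> 0 < rho \<theta> x"
  by (cases \<theta>) (auto simp: rho_def admissible_def intro: add_nonneg_pos)

lemma norm_le_sqrt_rho: "admissible \<theta> \<Longrightarrow> norm x \<le> sqrt (rho \<theta> x)"
  by (cases \<theta>) (auto simp: rho_def admissible_def norm_eq_sqrt_inner)

lemma norm_planar_le:
  assumes "p \<noteq> q"
  shows "norm (planar p q x) \<le> norm x"
proof -
  have "(x $ p)\<^sup>2 + (x $ q)\<^sup>2 = (\<Sum>i\<in>{p, q}. (x $ i)\<^sup>2)"
    using assms by simp
  also have "\<dots> \<le> (\<Sum>i\<in>UNIV. (x $ i)\<^sup>2)"
    by (rule sum_mono2) auto
  finally show ?thesis
    by (simp add: planar_def cmod_def norm_eq_sqrt_inner inner_vec_def power2_eq_square)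
qed

text \<open>The square root of \<open>rho\<close> plays the part of |x| and dominates it, which
  settles the coordinates and the powers of \<open>planar\<close>. Being positive, it also allows
  the negative exponents that come from 1 / rho.\<close>

lemma weighted_bound:
  fixes F :: "params \<Rightarrow> real ^ 'n::finite \<Rightarrow> real"
  assumes "weighted S p q w F" "p \<noteq> q" "diff_closed S"
  shows "\<exists>C\<ge>0. \<forall>\<theta> x. admissible \<theta> \<longrightarrow> \<bar>F \<theta> x\<bar> \<le> C * sqrt (rho \<theta> x) powi w"
  using assms(1)
proof induction
  case (zero w)
  then show ?case by (auto intro!: exI[of _ 0])
next
  case (const c)
  then show ?case by (auto intro!: exI[of _ "\<bar>c\<bar>"])
next
  case eps
  then show ?case by (auto intro!: exI[of _ 1] simp: admissible_def)
next
  case (coord i)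
  have "\<bar>x $ i\<bar> \<le> sqrt (rho \<theta> x)" if "admissible \<theta>" for \<theta> and x :: "real ^ 'n"
    using component_le_norm_cart[of x i] norm_le_sqrt_rho[OF that, of x] by linarith
  then show ?case by (auto intro!: exI[of _ 1])
next
  case (harmonic l c)
  have "\<bar>Re (c * planar p q x ^ l)\<bar> \<le> norm c * sqrt (rho \<theta> x) ^ l"
    if "admissible \<theta>" for \<theta> and x :: "real ^ 'n"
  proof -
    have "\<bar>Re (c * planar p q x ^ l)\<bar> \<le> norm c * norm (planar p q x) ^ l"
      by (metis abs_Re_le_cmod norm_mult norm_power)
    also have "\<dots> \<le> norm c * sqrt (rho \<theta> x) ^ l"
      using norm_planar_le[OF assms(2), of x] norm_le_sqrt_rho[OF that, of x]
      by (intro mult_left_mono power_mono) auto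
    finally show ?thesis .
  qed
  then show ?case by (auto intro!: exI[of _ "norm c"])
next
  case inverse_rho
  have "\<bar>1 / rho \<theta> x\<bar> \<le> sqrt (rho \<theta> x) powi (- 2)" if "admissible \<theta>" for \<theta> and x :: "real ^ 'n"
    using rho_pos[OF that, of x] by (simp add: power_int_minus divide_inverse)
  then show ?case by (auto intro!: exI[of _ 1])
next
  case (cutoff h)
  then have "bounded (range h)"
    using assms(3) by (simp add: diff_closed_def)
  then obtain C where "\<And>s. \<bar>h s\<bar> \<le> C"
    by (auto simp: bounded_iff)
  moreover from this have "C \<ge> 0"
    by (meson abs_ge_zero order_trans)
  ultimately show ?case by auto
next
  case (add w F G)
  then obtain C D where "C \<ge> 0" "D \<ge> 0"
    and C: "\<And>\<theta> x. admissible \<theta> \<Longrightarrow> \<bar>F \<theta> x\<bar> \<le> C * sqrt (rho \<theta> x) powi w"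
    and D: "\<And>\<theta> x. admissible \<theta> \<Longrightarrow> \<bar>G \<theta> x\<bar> \<le> D * sqrt (rho \<theta> x) powi w"
    by auto
  have "\<bar>F \<theta> x + G \<theta> x\<bar> \<le> (C + D) * sqrt (rho \<theta> x) powi w" if "admissible \<theta>" for \<theta> x
    using C[OF that, of x] D[OF that, of x] abs_triangle_ineq[of "F \<theta> x" "G \<theta> x"]
    by (simp add: distrib_right)
  then show ?case
    using \<open>C \<ge> 0\<close> \<open>D \<ge> 0\<close> by (intro exI[of _ "C + D"]) auto
next
  case (mult w F w' G)
  then obtain C D where "C \<ge> 0" "D \<ge> 0"
    and C: "\<And>\<theta> x. admissible \<theta> \<Longrightarrow> \<bar>F \<theta> x\<bar> \<le> C * sqrt (rho \<theta> x) powi w"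
    and D: "\<And>\<theta> x. admissible \<theta> \<Longrightarrow> \<bar>G \<theta> x\<bar> \<le> D * sqrt (rho \<theta> x) powi w'"
    by auto
  have "\<bar>F \<theta> x * G \<theta> x\<bar> \<le> (C * D) * sqrt (rho \<theta> x) powi (w + w')" if "admissible \<theta>" for \<theta> x
  proof -
    have "\<bar>F \<theta> x * G \<theta> x\<bar> \<le> (C * sqrt (rho \<theta> x) powi w) * (D * sqrt (rho \<theta> x) powi w')"
      unfolding abs_mult using C[OF that, of x] D[OF that, of x] by (intro mult_mono') auto
    also have "\<dots> = (C * D) * sqrt (rho \<theta> x) powi (w + w')"
      using rho_pos[OF that, of x] by (simp add: power_int_add)
    finally show ?thesis .
  qed
  then show ?case
    using \<open>C \<ge> 0\<close> \<open>D \<ge> 0\<close> by (intro exI[of _ "C * D"]) auto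
qed

text \<open>With every Frechet derivative written in coordinates, a single
  \<open>has_derivative\<close> statement yields differentiability together with the values of all
  partial derivatives.\<close>

definition gradient_form :: "('n \<Rightarrow> real) \<Rightarrow> real ^ 'n::finite \<Rightarrow> real" where
  "gradient_form g h = (\<Sum>i\<in>UNIV. g i * h $ i)"

lemma gradient_form_axis [simp]: "gradient_form g (axis i 1) = g i"
  by (simp add: gradient_form_def axis_def if_distrib[of "\<lambda>x. _ * x"] cong: if_cong)

lemma gradient_form_add: "gradient_form g h + gradient_form g' h = gradient_form (\<lambda>i. g i + g' i) h"
  by (simp add: gradient_form_def sum.distrib distrib_right)

lemma gradient_form_scale: "c * gradient_form g h = gradient_form (\<lambda>i. c * g i) h"
  by (simp add: gradient_form_def sum_distrib_left mult.assoc)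

lemma has_derivative_mult_gradient_form:
  assumes "(f has_derivative gradient_form f') (at x)" "(g has_derivative gradient_form g') (at x)"
  shows "((\<lambda>x. f x * g x) has_derivative gradient_form (\<lambda>i. f x * g' i + f' i * g x)) (at x)"
proof -
  have "(\<lambda>h. f x * gradient_form g' h + gradient_form f' h * g x)
      = gradient_form (\<lambda>i. f x * g' i + f' i * g x)"
    by (simp add: fun_eq_iff gradient_form_add[symmetric] gradient_form_scale mult.commute[of _ "g x"])
  then show ?thesis
    using has_derivative_mult[OF assms] by simp
qed

lemma gradient_form_zero [simp]: "gradient_form (\<lambda>i. 0) h = 0"
  by (simp add: gradient_form_def)

lemma gradient_form_single: "gradient_form (\<lambda>i. if i = j then c else 0) h = c * h $ j"
  by (simp add: gradient_form_def if_distrib[of "\<lambda>x. x * _"] cong: if_cong)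

lemma weighted_scale: "weighted S p q w F \<Longrightarrow> weighted S p q w (\<lambda>\<theta> x. c * F \<theta> x)"
  using weighted.mult[OF weighted.const, of S p q w F c] by simp

lemma rho_has_derivative:
  "(rho \<theta> has_derivative gradient_form (\<lambda>i. 2 * x $ i)) (at x)"
proof -
  obtain e b d where \<theta>: "\<theta> = (e, b, d)"
    by (cases \<theta>)
  have "gradient_form (\<lambda>i. 2 * x $ i) = (\<lambda>h. x \<bullet> h + h \<bullet> x)"
    by (simp add: gradient_form_def inner_vec_def fun_eq_iff sum.distrib[symmetric] algebra_simps)
  moreover have "((\<lambda>x. x \<bullet> x + d) has_derivative (\<lambda>h. x \<bullet> h + h \<bullet> x)) (at x)"
    by (auto intro!: derivative_eq_intros)
  ultimately show ?thesis
    by (simp add: rho_def \<theta>)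
qed

lemma phase_eq: "phase \<theta> x = fst \<theta> * ln (rho \<theta> x) + fst (snd \<theta>)"
  by (cases \<theta>) (simp add: phase_def rho_def)

lemma phase_has_derivative:
  assumes "admissible \<theta>"
  shows "(phase \<theta> has_derivative gradient_form (\<lambda>i. fst \<theta> * (1 / rho \<theta> x * (2 * x $ i)))) (at x)"
proof -
  have "((\<lambda>t. fst \<theta> * ln t + fst (snd \<theta>)) has_real_derivative fst \<theta> * (1 / rho \<theta> x)) (at (rho \<theta> x))"
    using rho_pos[OF assms, of x] by (auto intro!: derivative_eq_intros)
  from has_derivative_compose[OF rho_has_derivative this[unfolded has_field_derivative_def]]
  show ?thesis
    by (simp add: phase_eq[abs_def] gradient_form_scale mult.assoc)
qed

lemma linear_planar: "linear (planar p q)"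
  by (intro linearI) (auto simp: planar_def complex_eq_iff)

lemma linear_eq_gradient_form:
  assumes "linear f"
  shows "f = gradient_form (\<lambda>i. f (axis i 1))"
proof
  fix h
  have "f h = f (\<Sum>i\<in>UNIV. h $ i *\<^sub>R axis i 1)"
    using basis_expansion[of h] by (simp add: scalar_mult_eq_scaleR)
  also have "\<dots> = gradient_form (\<lambda>i. f (axis i 1)) h"
    by (simp add: gradient_form_def linear_sum[OF assms] linear_scale[OF assms] mult.commute)
  finally show "f h = gradient_form (\<lambda>i. f (axis i 1)) h" .
qed

text \<open>The result has the same shape with a new complex coefficient, so these functions are
  closed under differentiation. For l = 0 the truncated exponent is harmless, since the coefficient
  is 0.\<close>

lemma harmonic_has_derivative:
  "((\<lambda>x. Re (c * planar p q x ^ l)) has_derivative gradient_form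
     (\<lambda>i. Re (of_nat l * c * planar p q (axis i 1) * planar p q x ^ (l - 1)))) (at x)"
proof -
  have "((\<lambda>x. c * planar p q x ^ l) has_derivative
      (\<lambda>h. of_nat l * c * planar p q h * planar p q x ^ (l - 1))) (at x)"
    by (auto intro!: derivative_eq_intros linear_imp_has_derivative linear_planar simp: mult_ac)
  then have "((\<lambda>x. Re (c * planar p q x ^ l)) has_derivative
      (\<lambda>h. Re (of_nat l * c * planar p q h * planar p q x ^ (l - 1)))) (at x)"
    by (rule has_derivative_Re)
  moreover have "linear (\<lambda>h. Re (of_nat l * c * planar p q h * planar p q x ^ (l - 1)))"
    by (intro linearI)
       (simp_all only: linear_add[OF linear_planar] linear_scale[OF linear_planar] distrib_left
          distrib_right mult_scaleR_left mult_scaleR_right plus_complex.sel scaleR_complex.sel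
          real_scaleR_def)
  ultimately show ?thesis
    by (rule has_derivative_eq_rhs[OF _ linear_eq_gradient_form])
qed

lemma cutoff_has_derivative:
  assumes "admissible \<theta>" "\<And>s. (h has_real_derivative h' s) (at s)"
  shows "((\<lambda>x. h (phase \<theta> x)) has_derivative gradient_form
    (\<lambda>i. h' (phase \<theta> x) * (fst \<theta> * (1 / rho \<theta> x * (2 * x $ i))))) (at x)"
  using has_derivative_compose[OF phase_has_derivative[OF assms(1), of x]
      assms(2)[unfolded has_field_derivative_def]]
  by (simp add: gradient_form_scale)

text \<open>Each generator is checked by hand: 1 / rho gives -2 x_i / rho^2 of weight 1 - 4, and the
  cutoff gives e h' 2 x_i / rho of weight 1 - 2. Sums and products follow from the linearity of the
  derivative and the Leibniz rule.\<close>

lemma weighted_has_derivative: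
  fixes F :: "params \<Rightarrow> real ^ 'n::finite \<Rightarrow> real"
  assumes "weighted S p q w F" "diff_closed S"
  shows "\<exists>G. (\<forall>i. weighted S p q (w - 1) (G i)) \<and>
    (\<forall>\<theta> x. admissible \<theta> \<longrightarrow> (F \<theta> has_derivative gradient_form (\<lambda>i. G i \<theta> x)) (at x))"
  using assms(1)
proof induction
  case (zero w)
  then show ?case
    by (intro exI[of _ "\<lambda>i \<theta> x. 0"]) (auto intro: weighted.zero)
next
  case (const c)
  then show ?case
    by (intro exI[of _ "\<lambda>i \<theta> x. 0"]) (auto intro: weighted.zero)
next
  case eps
  then show ?case
    by (intro exI[of _ "\<lambda>i \<theta> x. 0"]) (auto intro: weighted.zero)
next
  case (coord j)
  have "((\<lambda>x. x $ j) has_derivative gradient_form (\<lambda>i. if i = j then 1 else 0)) (at x)" for x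
    unfolding gradient_form_single
    by (auto intro!: bounded_linear_imp_has_derivative bounded_linear_vec_nth)
  then show ?case
    by (intro exI[of _ "\<lambda>i \<theta> x. if i = j then 1 else 0"]) (auto intro: weighted.const)
next
  case (harmonic l c)
  let ?c = "\<lambda>i. of_nat l * c * planar p q (axis i 1)"
  \<comment> \<open>For l = 0 the weight is -1, out of reach of \<open>harmonic\<close>; the
    derivative is then 0, which has every weight.\<close>
  have "weighted S p q (int l - 1) (\<lambda>\<theta> x. Re (?c i * planar p q x ^ (l - 1)))" for i
    using weighted.harmonic[of S p q "l - 1" "?c i"] weighted.zero[of S p q "int l - 1"]
    by (cases "l = 0") (auto simp: of_nat_diff)
  then show ?case
    using harmonic_has_derivative
    by (intro exI[of _ "\<lambda>i \<theta> x. Re (?c i * planar p q x ^ (l - 1))"]) blast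
next
  case inverse_rho
  let ?G = "\<lambda>i \<theta> (x :: real ^ 'n). (- 2) * (x $ i * (1 / rho \<theta> x * (1 / rho \<theta> x)))"
  have "weighted S p q (- 2 - 1) (?G i)" for i
    using weighted_scale[OF weighted.mult[OF weighted.coord weighted.mult[OF weighted.inverse_rho
            weighted.inverse_rho]], of S p q "- 2" i] by simp
  moreover have "((\<lambda>x. 1 / rho \<theta> x) has_derivative gradient_form (\<lambda>i. ?G i \<theta> x)) (at x)"
    if "admissible \<theta>" for \<theta> x
  proof -
    have "((\<lambda>t. 1 / t) has_real_derivative - (1 / rho \<theta> x * (1 / rho \<theta> x))) (at (rho \<theta> x))"
      using rho_pos[OF that, of x] by (auto intro!: derivative_eq_intros)
    from has_derivative_compose[OF rho_has_derivative this[unfolded has_field_derivative_def]]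
    show ?thesis
      by (simp add: gradient_form_scale mult_ac)
  qed
  ultimately show ?case
    by (intro exI[of _ ?G]) blast
next
  case (cutoff h)
  then obtain h' where h': "h' \<in> S" "\<And>s. (h has_real_derivative h' s) (at s)"
    using assms(2) unfolding diff_closed_def by blast
  let ?G = "\<lambda>i \<theta> (x :: real ^ 'n). h' (phase \<theta> x) * (fst \<theta> * (1 / rho \<theta> x * (2 * x $ i)))"
  have "weighted S p q (0 - 1) (?G i)" for i
    using weighted.mult[OF weighted.cutoff[OF h'(1)] weighted.mult[OF weighted.eps
          weighted.mult[OF weighted.inverse_rho weighted_scale[OF weighted.coord]]], of p q 2 i] by simp
  moreover have "((\<lambda>x. h (phase \<theta> x)) has_derivative gradient_form (\<lambda>i. ?G i \<theta> x)) (at x)"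
    if "admissible \<theta>" for \<theta> x
    by (rule cutoff_has_derivative[OF that h'(2)])
  ultimately show ?case
    by (intro exI[of _ ?G]) blast
next
  case (add w F G)
  then obtain F' G' where
    F': "\<And>i. weighted S p q (w - 1) (F' i)"
      "\<And>\<theta> x. admissible \<theta> \<Longrightarrow> (F \<theta> has_derivative gradient_form (\<lambda>i. F' i \<theta> x)) (at x)" and
    G': "\<And>i. weighted S p q (w - 1) (G' i)"
      "\<And>\<theta> x. admissible \<theta> \<Longrightarrow> (G \<theta> has_derivative gradient_form (\<lambda>i. G' i \<theta> x)) (at x)"
    by metis
  show ?case
    using weighted.add[OF F'(1) G'(1)] has_derivative_add[OF F'(2) G'(2)]
    by (intro exI[of _ "\<lambda>i \<theta> x. F' i \<theta> x + G' i \<theta> x"]) (simp add: gradient_form_add)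
next
  case (mult w F w' G)
  then obtain F' G' where
    F': "\<And>i. weighted S p q (w - 1) (F' i)"
      "\<And>\<theta> x. admissible \<theta> \<Longrightarrow> (F \<theta> has_derivative gradient_form (\<lambda>i. F' i \<theta> x)) (at x)" and
    G': "\<And>i. weighted S p q (w' - 1) (G' i)"
      "\<And>\<theta> x. admissible \<theta> \<Longrightarrow> (G \<theta> has_derivative gradient_form (\<lambda>i. G' i \<theta> x)) (at x)"
    by metis
  let ?H = "\<lambda>i \<theta> x. F \<theta> x * G' i \<theta> x + F' i \<theta> x * G \<theta> x"
  have "weighted S p q (w + w' - 1) (?H i)" for i
    using weighted.add[of S p q "w + w' - 1"] weighted.mult[OF mult.hyps(1) G'(1)[of i]]
      weighted.mult[OF F'(1)[of i] mult.hyps(2)] by (simp add: algebra_simps)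
  moreover have "((\<lambda>x. F \<theta> x * G \<theta> x) has_derivative gradient_form (\<lambda>i. ?H i \<theta> x)) (at x)"
    if "admissible \<theta>" for \<theta> x
    by (rule has_derivative_mult_gradient_form[OF F'(2)[OF that] G'(2)[OF that]])
  ultimately show ?case
    by (intro exI[of _ ?H]) blast
qed

text \<open>One family \<open>G\<close> serves all parameters, so a bound for it is a uniform bound
  for the derivatives.\<close>

lemma weighted_iter_partial:
  fixes F :: "params \<Rightarrow> real ^ 'n::finite \<Rightarrow> real"
  assumes "weighted S p q w F" "diff_closed S"
  shows "\<exists>G. weighted S p q (w - int (length is)) G \<and>
    (\<forall>\<theta>. admissible \<theta> \<longrightarrow> iter_partial is (F \<theta>) = G \<theta>)"
proof (induction "is")
  case Nil
  show ?case
    using assms(1) by auto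
next
  case (Cons i "is")
  then obtain G where G: "weighted S p q (w - int (length is)) G"
    "\<And>\<theta>. admissible \<theta> \<Longrightarrow> iter_partial is (F \<theta>) = G \<theta>"
    by blast
  obtain G' where G': "weighted S p q (w - int (length is) - 1) (G' i)"
    "\<And>\<theta> x. admissible \<theta> \<Longrightarrow> (G \<theta> has_derivative gradient_form (\<lambda>i. G' i \<theta> x)) (at x)"
    using weighted_has_derivative[OF G(1) assms(2)] by blast
  have "partial i (G \<theta>) = G' i \<theta>" if "admissible \<theta>" for \<theta>
    by (rule ext) (simp add: partial_eq[OF G'(2)[OF that]])
  then have "iter_partial (i # is) (F \<theta>) = G' i \<theta>" if "admissible \<theta>" for \<theta>
    using G(2) that by simp
  moreover have "w - int (length (i # is)) = w - int (length is) - 1"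
    by simp
  ultimately show ?case
    using G'(1) by metis
qed

lemma weighted_smooth:
  fixes F :: "params \<Rightarrow> real ^ 'n::finite \<Rightarrow> real"
  assumes "weighted S p q w F" "diff_closed S" "admissible \<theta>"
  shows "smooth_fun (F \<theta>)"
  unfolding smooth_fun_def
proof (intro allI)
  fix "is" x
  obtain G where G: "weighted S p q (w - int (length is)) G" "iter_partial is (F \<theta>) = G \<theta>"
    using weighted_iter_partial[OF assms(1,2), of "is"] assms(3) by blast
  then show "iter_partial is (F \<theta>) differentiable (at x)"
    using weighted_has_derivative[OF G(1) assms(2)] assms(3) differentiableI by metis
qed

lemma weighted_iter_partial_bound:
  fixes F :: "params \<Rightarrow> real ^ 'n::finite \<Rightarrow> real"
  assumes "weighted S p q w F" "p \<noteq> q" "diff_closed S"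
  shows "\<exists>C\<ge>0. \<forall>\<theta> x. admissible \<theta> \<longrightarrow>
    \<bar>iter_partial is (F \<theta>) x\<bar> \<le> C * sqrt (rho \<theta> x) powi (w - int (length is))"
proof -
  obtain G where G: "weighted S p q (w - int (length is)) G"
    "\<And>\<theta>. admissible \<theta> \<Longrightarrow> iter_partial is (F \<theta>) = G \<theta>"
    using weighted_iter_partial[OF assms(1,3), of "is"] by blast
  show ?thesis
    using weighted_bound[OF G(1) assms(2,3)] by (simp add: G(2) cong: imp_cong)
qed

section \<open>The Laplacian of a harmonic polynomial times the cutoff\<close>

text \<open>The harmonic factor kills the only term of the Laplacian in which the cutoff is not
  differentiated, and each derivative of the cutoff brings out a factor \<open>e\<close>.\<close>

lemma laplacian_cutoff_harmonic:
  fixes p q :: "'n::finite"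
  assumes "p \<noteq> q" "diff_closed S" "\<eta> \<in> S"
  shows "\<exists>G. weighted S p q (int m - 2) G \<and> (\<forall>\<theta>. admissible \<theta> \<longrightarrow>
    laplacian (\<lambda>x. Re (planar p q x ^ m) * \<eta> (phase \<theta> x)) = (\<lambda>x. fst \<theta> * G \<theta> x))"
proof -
  obtain \<eta>' where \<eta>': "\<eta>' \<in> S" "\<And>s. (\<eta> has_real_derivative \<eta>' s) (at s)"
    using assms(2,3) unfolding diff_closed_def by blast
  define d where "d i = planar p q (axis i 1)" for i
  define H where "H x = Re (planar p q x ^ m)" for x
  define H1 where "H1 i x = Re (of_nat m * d i * planar p q x ^ (m - 1))" for i x
  define H2 where "H2 i x = Re (of_nat (m - 1) * (of_nat m * d i * d i) * planar p q x ^ (m - 1 - 1))"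
    for i x
  \<comment> \<open>The products of H and \<open>H1 i\<close> with the i-th partial derivative of
    the cutoff, after its factor e has been split off.\<close>
  define A where "A i \<theta> x = H x * (\<eta>' (phase \<theta> x) * (1 / rho \<theta> x * (2 * x $ i)))" for i \<theta> x
  define B where "B i \<theta> x = H1 i x * (\<eta>' (phase \<theta> x) * (1 / rho \<theta> x * (2 * x $ i)))" for i \<theta> x
  have H: "(H has_derivative gradient_form (\<lambda>i. H1 i x)) (at x)" for x
    using harmonic_has_derivative[of 1 p q m x] by (simp add: H_def[abs_def] H1_def d_def)
  have H1: "(H1 i has_derivative gradient_form (\<lambda>j. Re (of_nat (m - 1) * (of_nat m * d i * d j)
      * planar p q x ^ (m - 1 - 1)))) (at x)" for i x
    using harmonic_has_derivative[of "of_nat m * d i" p q "m - 1" x]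
    unfolding H1_def[abs_def] d_def mult.assoc .
  \<comment> \<open>Harmonicity: only p and q contribute, with \<open>d p\<close> = 1 and
    \<open>d q\<close> the imaginary unit, and their squares add up to 0.\<close>
  have H2: "(\<Sum>i\<in>UNIV. H2 i x) = 0" for x
  proof -
    have "(\<Sum>i\<in>UNIV. H2 i x) = (\<Sum>i\<in>{p, q}. H2 i x)"
      by (intro sum.mono_neutral_right) (auto simp: H2_def d_def planar_def axis_def)
    also have "\<dots> = 0"
      using assms(1) by (simp add: H2_def d_def planar_def axis_def algebra_simps)
    finally show ?thesis .
  qed
  have wA: "weighted S p q (int m - 1) (A i)" for i
    using weighted.mult[OF weighted.harmonic weighted.mult[OF weighted.cutoff[OF \<eta>'(1)]
          weighted.mult[OF weighted.inverse_rho weighted_scale[OF weighted.coord]]], of p q m 1 2 i]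
    by (simp add: A_def[abs_def] H_def)
  \<comment> \<open>The case m = 0 is separate because the natural number m - 1 would be truncated;
    \<open>H1 i\<close> is then 0.\<close>
  have wB: "weighted S p q (int m - 2) (B i)" for i
  proof (cases "m = 0")
    case True
    then show ?thesis
      using weighted.zero[of S p q "- 2"] by (simp add: B_def[abs_def] H1_def)
  next
    case False
    then show ?thesis
      using weighted.mult[OF weighted.harmonic weighted.mult[OF weighted.cutoff[OF \<eta>'(1)]
            weighted.mult[OF weighted.inverse_rho weighted_scale[OF weighted.coord]]],
          of p q "m - 1" "of_nat m * d i" 2 i]
      by (simp add: B_def[abs_def] H1_def of_nat_diff)
  qed
  have "\<exists>A'. weighted S p q (int m - 2) A' \<and>
    (\<forall>\<theta>. admissible \<theta> \<longrightarrow> A i \<theta> differentiable_on UNIV \<and> partial i (A i \<theta>) = A' \<theta>)" for i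
  proof -
    obtain G' where G': "weighted S p q (int m - 1 - 1) (G' i)"
      "\<And>\<theta> x. admissible \<theta> \<Longrightarrow> (A i \<theta> has_derivative gradient_form (\<lambda>i. G' i \<theta> x)) (at x)"
      using weighted_has_derivative[OF wA assms(2)] by blast
    have "A i \<theta> differentiable_on UNIV" if "admissible \<theta>" for \<theta>
      unfolding differentiable_on_def using differentiableI[OF G'(2)[OF that]] by blast
    moreover have "partial i (A i \<theta>) = G' i \<theta>" if "admissible \<theta>" for \<theta>
      by (rule ext) (simp add: partial_eq[OF G'(2)[OF that]])
    ultimately show ?thesis
      using G'(1) by (intro exI[of _ "G' i"]) simp
  qed
  then obtain A' where A': "\<And>i. weighted S p q (int m - 2) (A' i)"
    "\<And>i \<theta>. admissible \<theta> \<Longrightarrow> A i \<theta> differentiable_on UNIV"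
    "\<And>i \<theta>. admissible \<theta> \<Longrightarrow> partial i (A i \<theta>) = A' i \<theta>"
    by metis
  define G where "G \<theta> x = (\<Sum>i\<in>UNIV. B i \<theta> x + A' i \<theta> x)" for \<theta> x
  have wG: "weighted S p q (int m - 2) G"
    unfolding G_def[abs_def] using wB A'(1) by (intro weighted_sum weighted.add) auto
  have "laplacian (\<lambda>x. H x * \<eta> (phase \<theta> x)) x = fst \<theta> * G \<theta> x" if \<theta>: "admissible \<theta>" for \<theta> x
  proof -
    note \<eta>D = cutoff_has_derivative[OF \<theta> \<eta>'(2)]
    \<comment> \<open>In this grouping the second differentiation needs only the existence and the
      weight of the derivative of \<open>A i\<close>, no formula for it.\<close>
    have first: "partial i (\<lambda>x. H x * \<eta> (phase \<theta> x)) = (\<lambda>x. H1 i x * \<eta> (phase \<theta> x) + fst \<theta> * A i \<theta> x)" for i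
      using partial_eq[OF has_derivative_mult_gradient_form[OF H \<eta>D]]
      by (simp add: fun_eq_iff A_def algebra_simps)
    have second: "partial i (\<lambda>x. H1 i x * \<eta> (phase \<theta> x) + fst \<theta> * A i \<theta> x) x =
        H2 i x * \<eta> (phase \<theta> x) + fst \<theta> * (B i \<theta> x + A' i \<theta> x)" for i
    proof -
      obtain D where D: "(A i \<theta> has_derivative D) (at x)"
        using A'(2)[OF \<theta>, of i] by (auto simp: differentiable_on_def differentiable_def)
      have D1: "D (axis i 1) = A' i \<theta> x"
        using partial_eq[OF D, of i] A'(3)[OF \<theta>, of i] by simp
      show ?thesis
        using partial_eq[OF has_derivative_add[OF has_derivative_mult_gradient_form[OF H1 \<eta>D]
              has_derivative_mult_right[OF D]], of i i "fst \<theta>"]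
        by (simp add: D1 H2_def B_def algebra_simps)
    qed
    have "laplacian (\<lambda>x. H x * \<eta> (phase \<theta> x)) x =
        (\<Sum>i\<in>UNIV. H2 i x * \<eta> (phase \<theta> x) + fst \<theta> * (B i \<theta> x + A' i \<theta> x))"
      by (simp add: laplacian_def first second)
    also have "\<dots> = (\<Sum>i\<in>UNIV. H2 i x) * \<eta> (phase \<theta> x) + fst \<theta> * G \<theta> x"
      by (simp only: G_def sum.distrib sum_distrib_left sum_distrib_right distrib_left)
    finally show ?thesis
      by (simp add: H2)
  qed
  then show ?thesis
    using wG unfolding H_def by blast
qed

section \<open>The derivative of top order of the harmonic polynomial\<close>

lemma iter_partial_snoc: "iter_partial (is @ [i]) f = iter_partial is (partial i f)"
  by (induction "is") auto

lemma planar_axis: "p \<noteq> q \<Longrightarrow> planar p q (axis p 1) = 1"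
  by (simp add: planar_def axis_def complex_eq_iff)

text \<open>Since \<open>planar\<close> maps the axis p to 1, the partial derivative in direction p
  acts on powers of x_p + i x_q as complex differentiation. The induction removes the innermost
  derivative, so the coefficient must be arbitrary.\<close>

lemma iter_partial_harmonic:
  fixes p q :: "'n::finite"
  assumes "p \<noteq> q"
  shows "iter_partial (replicate l p) (\<lambda>x. Re (c * planar p q x ^ l)) x = Re c * fact l"
proof (induction l arbitrary: c)
  case (Suc l)
  have "partial p (\<lambda>x. Re (c * planar p q x ^ Suc l)) =
      (\<lambda>x. Re (of_nat (Suc l) * c * planar p q x ^ l))"
    using partial_eq[OF harmonic_has_derivative[of c p q "Suc l"], of p] assms
    by (simp add: fun_eq_iff planar_axis del: power_Suc of_nat_Suc)
  then have "iter_partial (replicate (Suc l) p) (\<lambda>x. Re (c * planar p q x ^ Suc l)) x =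
      Re (of_nat (Suc l) * c) * fact l"
    by (simp only: replicate_Suc replicate_append_same[symmetric] iter_partial_snoc Suc.IH)
  then show ?case
    by (simp add: algebra_simps)
qed simp

text \<open>Used with t the square root of \<open>rho\<close>: a positive weight leaves a factor r,
  whereas weight 0 gives boundedness only, and smallness must then come from e.\<close>

lemma power_int_le_scaled:
  fixes t r :: real
  assumes "0 < t" "t \<le> 2 * r" "r \<le> 1"
  shows "t powi int d \<le> 2 ^ d" and "d > 0 \<Longrightarrow> t powi int d \<le> 2 ^ d * r"
proof -
  have *: "t ^ d \<le> 2 ^ d * r ^ d"
    using power_mono[of t "2 * r" d] assms by (simp add: power_mult_distrib)
  have "2 ^ d * r ^ d \<le> 2 ^ d * (1 :: real)"
    using assms by (intro mult_left_mono power_le_one) auto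
  from order_trans[OF * this] show "t powi int d \<le> 2 ^ d"
    by simp
  show "t powi int d \<le> 2 ^ d * r" if "d > 0"
  proof -
    have "2 ^ d * r ^ d \<le> 2 ^ d * r"
      using power_decreasing[of 1 d r] that assms by (intro mult_left_mono) auto
    from order_trans[OF * this] show ?thesis
      by simp
  qed
qed

section \<open>Bumps with independent slope e and radius r\<close>

text \<open>The product has weight k + 2, so its derivatives of lower order keep a positive weight
  and are O(r). Its Laplacian is e times a family of weight k, so derivatives up to order k are
  O(e), uniformly in r <= 1. The factor 1/2 in \<open>D\<close> below shares r^2 exp(-1/e) equally
  between |x|^2 and the shift of the logarithm.\<close>

lemma bump_family_exists:
  fixes p q :: "'n::finite"
  assumes "p \<noteq> q"
  obtains v :: "real \<Rightarrow> real \<Rightarrow> real ^ 'n \<Rightarrow> real" where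
    "\<And>e r. 0 < e \<Longrightarrow> e \<le> 1 \<Longrightarrow> 0 < r \<Longrightarrow> smooth_fun (v e r)"
    "\<And>e r. 0 < e \<Longrightarrow> e \<le> 1 \<Longrightarrow> 0 < r \<Longrightarrow> smooth_fun (laplacian (v e r))"
    "\<And>e r x. 0 < e \<Longrightarrow> e \<le> 1 \<Longrightarrow> 0 < r \<Longrightarrow> r \<le> norm x \<Longrightarrow> v e r x = 0"
    "\<And>e r. 0 < e \<Longrightarrow> e \<le> 1 \<Longrightarrow> 0 < r \<Longrightarrow> iter_partial (replicate (k + 2) p) (v e r) 0 = fact (k + 2)"
    "\<And>is. length is < k + 2 \<Longrightarrow> \<exists>C\<ge>0. \<forall>e r x. 0 < e \<longrightarrow> e \<le> 1 \<longrightarrow> 0 < r \<longrightarrow> r \<le> 1 \<longrightarrow> norm x \<le> r \<longrightarrow>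
      \<bar>iter_partial is (v e r) x\<bar> \<le> C * r"
    "\<And>is. length is \<le> k \<Longrightarrow> \<exists>C\<ge>0. \<forall>e r x. 0 < e \<longrightarrow> e \<le> 1 \<longrightarrow> 0 < r \<longrightarrow> r \<le> 1 \<longrightarrow> norm x \<le> r \<longrightarrow>
      \<bar>iter_partial is (laplacian (v e r)) x\<bar> \<le> C * e"
proof -
  obtain S \<eta> where S: "diff_closed S" "\<eta> \<in> S" "\<And>s. s \<le> 0 \<Longrightarrow> \<eta> s = 1" "\<And>s. s \<ge> 1 \<Longrightarrow> \<eta> s = 0"
    using smooth_cutoff_exists by blast
  define F where "F \<theta> x = Re (planar p q x ^ (k + 2)) * \<eta> (phase \<theta> x)" for \<theta> and x :: "real ^ 'n"
  have wF: "weighted S p q (int (k + 2)) F"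
    using weighted.mult[OF weighted.harmonic weighted.cutoff[OF S(2)], of p q "k + 2" 1]
    by (simp add: F_def[abs_def])
  obtain G where wG: "weighted S p q (int k) G"
    and G: "\<And>\<theta>. admissible \<theta> \<Longrightarrow> laplacian (F \<theta>) = (\<lambda>x. fst \<theta> * G \<theta> x)"
    using laplacian_cutoff_harmonic[OF assms S(1,2), of "k + 2"] unfolding F_def[abs_def] by auto
  \<comment> \<open>With these parameters the phase is at least \<open>1\<close> for \<open>|x| \<ge> r\<close> and at most \<open>0\<close> for \<open>|x|\<^sup>2 \<le> D e r\<close>.\<close>
  define D where "D e r = r\<^sup>2 * exp (- (1 / e)) / 2" for e r :: real
  define par where "par e r = (e, 1 - e * ln (r\<^sup>2), D e r)" for e r :: real
  have D: "0 < D e r" "D e r \<le> r\<^sup>2" if "0 < e" "0 < r" for e r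
  proof -
    have "exp (- (1 / e)) \<le> 2"
      by (rule order_trans[of _ 1]) (use that in auto)
    then show "0 < D e r" "D e r \<le> r\<^sup>2"
      using that by (auto simp: D_def)
  qed
  have adm: "admissible (par e r)" if "0 < e" "e \<le> 1" "0 < r" for e r
    using that D by (auto simp: admissible_def par_def)
  have phase_out: "phase (par e r) x \<ge> 1" if "0 < e" "0 < r" "r \<le> norm x" for e r and x :: "real ^ 'n"
  proof -
    have "r\<^sup>2 \<le> x \<bullet> x + D e r"
      using D[OF that(1,2)] power_mono[OF that(3), of 2] that(2) by (simp add: power2_norm_eq_inner)
    then have "ln (r\<^sup>2) \<le> ln (x \<bullet> x + D e r)"
      using that by (intro ln_mono) auto
    then show ?thesis
      using mult_left_mono[of _ _ e] that by (auto simp: phase_def par_def)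
  qed
  have phase_in: "phase (par e r) x \<le> 0" if "0 < e" "0 < r" "x \<bullet> x \<le> D e r" for e r and x :: "real ^ 'n"
  proof -
    have "ln (x \<bullet> x + D e r) \<le> ln (r\<^sup>2 * exp (- (1 / e)))"
      using that D[OF that(1,2)] by (intro ln_mono) (auto simp: D_def intro: add_nonneg_pos)
    also have "\<dots> = ln (r\<^sup>2) - 1 / e"
      using that by (simp add: ln_mult)
    finally have "e * ln (x \<bullet> x + D e r) \<le> e * (ln (r\<^sup>2) - 1 / e)"
      using that by (intro mult_left_mono) auto
    then show ?thesis
      using that by (simp add: phase_def par_def right_diff_distrib)
  qed
  have sqrt_rho: "0 < sqrt (rho (par e r) x)" "sqrt (rho (par e r) x) \<le> 2 * r"
    if "0 < e" "e \<le> 1" "0 < r" "norm x \<le> r" for e r and x :: "real ^ 'n"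
  proof -
    show "0 < sqrt (rho (par e r) x)"
      using rho_pos[OF adm[OF that(1-3)]] by simp
    have "rho (par e r) x \<le> (2 * r)\<^sup>2"
      using D[OF that(1,3)] power_mono[OF that(4), of 2]
      by (simp add: rho_def par_def power2_norm_eq_inner power_mult_distrib)
    then show "sqrt (rho (par e r) x) \<le> 2 * r"
      using that real_le_lsqrt by force
  qed
  show ?thesis
  proof (rule that[of "\<lambda>e r. F (par e r)"])
    fix e r :: real assume er: "0 < e" "e \<le> 1" "0 < r"
    show "smooth_fun (F (par e r))"
      by (rule weighted_smooth[OF wF S(1) adm[OF er]])
    show "smooth_fun (laplacian (F (par e r)))"
      unfolding G[OF adm[OF er]]
      using smooth_fun_affine[OF weighted_smooth[OF wG S(1) adm[OF er]], of _ 0] by simp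
    show "F (par e r) x = 0" if "r \<le> norm x" for x
      using S(4)[OF phase_out[OF er(1,3) that]] by (simp add: F_def)
    have "iter_partial (replicate (k + 2) p) (F (par e r)) 0 =
        iter_partial (replicate (k + 2) p) (\<lambda>x. Re (1 * planar p q x ^ (k + 2))) 0"
    proof (rule iter_partial_cong_open)
      show "open (ball 0 (sqrt (D e r)) :: (real ^ 'n) set)"
        by simp
      show "0 \<in> ball 0 (sqrt (D e r))"
        using D[OF er(1,3)] by simp
      fix y :: "real ^ 'n" assume "y \<in> ball 0 (sqrt (D e r))"
      then have "y \<bullet> y \<le> D e r"
        by (simp add: norm_eq_sqrt_inner)
      from S(3)[OF phase_in[OF er(1,3) this]]
      show "F (par e r) y = Re (1 * planar p q y ^ (k + 2))"
        by (simp add: F_def)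
    qed
    then show "iter_partial (replicate (k + 2) p) (F (par e r)) 0 = fact (k + 2)"
      by (simp only: iter_partial_harmonic[OF assms]) simp
  next
    fix "is" :: "'n list" assume len: "length is < k + 2"
    obtain C where C: "C \<ge> 0" "\<And>\<theta> x. admissible \<theta> \<Longrightarrow>
        \<bar>iter_partial is (F \<theta>) x\<bar> \<le> C * sqrt (rho \<theta> x) powi (int (k + 2) - int (length is))"
      using weighted_iter_partial_bound[OF wF assms S(1)] by blast
    have "\<bar>iter_partial is (F (par e r)) x\<bar> \<le> (C * 2 ^ (k + 2 - length is)) * r"
      if "0 < e" "e \<le> 1" "0 < r" "r \<le> 1" "norm x \<le> r" for e r x
    proof -
      have "sqrt (rho (par e r) x) powi int (k + 2 - length is) \<le> 2 ^ (k + 2 - length is) * r"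
        by (rule power_int_le_scaled(2)[OF sqrt_rho[OF that(1-3,5)] that(4)]) (use len in simp)
      then have "C * sqrt (rho (par e r) x) powi int (k + 2 - length is) \<le>
          C * (2 ^ (k + 2 - length is) * r)"
        using C(1) by (rule mult_left_mono)
      moreover have "int (k + 2) - int (length is) = int (k + 2 - length is)"
        using len by simp
      ultimately show ?thesis
        using C(2)[OF adm[OF that(1-3)], of x] by (simp only: mult.assoc)
    qed
    then show "\<exists>C\<ge>0. \<forall>e r x. 0 < e \<longrightarrow> e \<le> 1 \<longrightarrow> 0 < r \<longrightarrow> r \<le> 1 \<longrightarrow> norm x \<le> r \<longrightarrow>
        \<bar>iter_partial is (F (par e r)) x\<bar> \<le> C * r"
      using C(1) by (intro exI[of _ "C * 2 ^ (k + 2 - length is)"]) simp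
  next
    fix "is" :: "'n list" assume len: "length is \<le> k"
    obtain C where C: "C \<ge> 0" "\<And>\<theta> x. admissible \<theta> \<Longrightarrow>
        \<bar>iter_partial is (G \<theta>) x\<bar> \<le> C * sqrt (rho \<theta> x) powi (int k - int (length is))"
      using weighted_iter_partial_bound[OF wG assms S(1)] by blast
    have "\<bar>iter_partial is (laplacian (F (par e r))) x\<bar> \<le> (C * 2 ^ (k - length is)) * e"
      if er: "0 < e" "e \<le> 1" "0 < r" "r \<le> 1" "norm x \<le> r" for e r x
    proof -
      have "C * sqrt (rho (par e r) x) powi int (k - length is) \<le> C * 2 ^ (k - length is)"
        by (intro mult_left_mono C(1) power_int_le_scaled(1)[OF sqrt_rho[OF er(1-3,5)] er(4)])
      moreover have "int k - int (length is) = int (k - length is)"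
        using len by simp
      ultimately have "\<bar>iter_partial is (G (par e r)) x\<bar> \<le> C * 2 ^ (k - length is)"
        using C(2)[OF adm[OF er(1-3)], of x] by (simp only:)
      moreover have "iter_partial is (laplacian (F (par e r))) x = e * iter_partial is (G (par e r)) x"
        unfolding G[OF adm[OF er(1-3)]]
        using iter_partial_affine[OF weighted_smooth[OF wG S(1) adm[OF er(1-3)]], of "is" e 0]
        by (simp add: par_def)
      ultimately show ?thesis
        using er(1) mult_left_mono[of _ _ e] by (simp add: abs_mult mult.commute)
    qed
    then show "\<exists>C\<ge>0. \<forall>e r x. 0 < e \<longrightarrow> e \<le> 1 \<longrightarrow> 0 < r \<longrightarrow> r \<le> 1 \<longrightarrow> norm x \<le> r \<longrightarrow>
        \<bar>iter_partial is (laplacian (F (par e r))) x\<bar> \<le> C * e"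
      using C(1) by (intro exI[of _ "C * 2 ^ (k - length is)"]) simp
  qed
qed

section \<open>Translated bumps with growing amplitudes\<close>

text \<open>Radii of at most |a_j| / 8 put the supports into disjoint shells around 0. Choosing the
  slope equal to the radius lets one estimate treat the bumps, which are O(r), and their Laplacians,
  which are O(e).\<close>

lemma scaled_bumps_exist:
  fixes p q :: "'n::finite"
  assumes "p \<noteq> q"
  obtains a :: "nat \<Rightarrow> real ^ 'n" and w :: "nat \<Rightarrow> real ^ 'n \<Rightarrow> real" where
    "\<And>j. norm (a j) = (1 / 4) ^ j"
    "\<And>j. smooth_fun (w j)"
    "\<And>j. smooth_fun (laplacian (w j))"
    "\<And>j x. norm (x - a j) \<ge> (1 / 4) ^ j / 8 \<Longrightarrow> w j x = 0"
    "\<And>j. iter_partial (replicate (k + 2) p) (w j) (a j) = (real j + 1) * fact (k + 2)"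
    "\<And>is. length is \<le> k + 1 \<Longrightarrow> \<exists>C. \<forall>j x. \<bar>iter_partial is (w j) x\<bar> \<le> C * (norm x)\<^sup>2"
    "\<And>is. length is \<le> k \<Longrightarrow> \<exists>C. \<forall>j x. \<bar>iter_partial is (laplacian (w j)) x\<bar> \<le> C * (norm x)\<^sup>2"
proof -
  obtain v :: "real \<Rightarrow> real \<Rightarrow> real ^ 'n \<Rightarrow> real" where
    v: "\<And>e r. 0 < e \<Longrightarrow> e \<le> 1 \<Longrightarrow> 0 < r \<Longrightarrow> smooth_fun (v e r)"
    and lv: "\<And>e r. 0 < e \<Longrightarrow> e \<le> 1 \<Longrightarrow> 0 < r \<Longrightarrow> smooth_fun (laplacian (v e r))"
    and v_out: "\<And>e r x. 0 < e \<Longrightarrow> e \<le> 1 \<Longrightarrow> 0 < r \<Longrightarrow> r \<le> norm x \<Longrightarrow> v e r x = 0"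
    and v_top: "\<And>e r. 0 < e \<Longrightarrow> e \<le> 1 \<Longrightarrow> 0 < r \<Longrightarrow>
      iter_partial (replicate (k + 2) p) (v e r) 0 = fact (k + 2)"
    and v_bound: "\<And>is. length is < k + 2 \<Longrightarrow> \<exists>C\<ge>0. \<forall>e r x. 0 < e \<longrightarrow> e \<le> 1 \<longrightarrow> 0 < r \<longrightarrow> r \<le> 1 \<longrightarrow>
      norm x \<le> r \<longrightarrow> \<bar>iter_partial is (v e r) x\<bar> \<le> C * r"
    and lv_bound: "\<And>is. length is \<le> k \<Longrightarrow> \<exists>C\<ge>0. \<forall>e r x. 0 < e \<longrightarrow> e \<le> 1 \<longrightarrow> 0 < r \<longrightarrow> r \<le> 1 \<longrightarrow>
      norm x \<le> r \<longrightarrow> \<bar>iter_partial is (laplacian (v e r)) x\<bar> \<le> C * e"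
    by (rule bump_family_exists[OF assms, of k]) (rule that)
  \<comment> \<open>Both the radius and the logarithmic slope are \<open>s j\<close>; the factor \<open>1 / (j + 1)\<close> compensates
    the amplitude \<open>j + 1\<close>, and \<open>(1 / 16)^j = |a j|\<^sup>2\<close>.\<close>
  define s where "s j = (1 / 16) ^ j / (8 * (real j + 1))" for j
  define a :: "nat \<Rightarrow> real ^ 'n" where "a j = (1 / 4) ^ j *\<^sub>R axis p 1" for j
  define w where "w j x = (real j + 1) * v (s j) (s j) (x - a j)" for j x
  have pw: "(1 / 16 :: real) ^ j = (1 / 4) ^ j * (1 / 4) ^ j" for j
    by (simp add: power_mult_distrib[symmetric])
  have pw1: "0 < (1 / 4 :: real) ^ j" "(1 / 4 :: real) ^ j \<le> 1" for j
    by (auto simp: power_le_one)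
  have norm_a: "norm (a j) = (1 / 4) ^ j" for j
    by (simp add: a_def)
  have s: "0 < s j" "s j \<le> (1 / 4) ^ j / 8" "s j \<le> 1" "(real j + 1) * s j = (1 / 16) ^ j / 8" for j
  proof -
    show "0 < s j"
      by (simp add: s_def)
    have "real j + 1 \<noteq> 0"
      by linarith
    then show "(real j + 1) * s j = (1 / 16) ^ j / 8"
      unfolding s_def by (metis divide_divide_eq_left' mult.commute nonzero_mult_div_cancel_left
          times_divide_eq_right)
    have "s j \<le> (1 / 16) ^ j / 8"
      unfolding s_def by (intro divide_left_mono) auto
    also have "\<dots> \<le> (1 / 4) ^ j / 8"
      using pw1[of j] by (auto simp: pw intro: mult_left_le)
    finally show "s j \<le> (1 / 4) ^ j / 8" .
    then show "s j \<le> 1"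
      using pw1(2)[of j] by simp
  qed
  \<comment> \<open>On the j-th support |x| is at least |a_j| / 2, so (j + 1) \<open>s j\<close> is
    at most |x|^2. This turns bounds in terms of the radius or the slope into quadratic bounds at
    the origin.\<close>
  have near: "(1 / 16) ^ j / 8 \<le> (norm x)\<^sup>2" if "norm (x - a j) \<le> s j" for j and x :: "real ^ 'n"
  proof -
    have "norm (a j) \<le> norm x + norm (x - a j)"
      using norm_triangle_ineq4[of x "x - a j"] by simp
    then have "1 / 2 * (1 / 4) ^ j \<le> norm x"
      using that s(2)[of j] pw1[of j] unfolding norm_a by linarith
    from power_mono[OF this, of 2] pw1[of j] have "1 / 4 * (1 / 16) ^ j \<le> (norm x)\<^sup>2"
      by (simp add: power2_eq_square pw)
    moreover have "0 < (1 / 16 :: real) ^ j"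
      by simp
    ultimately show ?thesis
      by linarith
  qed
  have w_out: "w j x = 0" if "s j \<le> norm (x - a j)" for j x
    using v_out[OF s(1,3,1) that] by (simp add: w_def)
  have lw: "laplacian (w j) = (\<lambda>x. (real j + 1) * laplacian (v (s j) (s j)) (x - a j))" for j
    unfolding w_def[abs_def] by (rule laplacian_affine[OF v[OF s(1,3,1)]])
  have bound: "\<exists>C. \<forall>j x. \<bar>iter_partial is (g j) x\<bar> \<le> C * (norm x)\<^sup>2"
    if g: "\<And>j. g j = (\<lambda>x. (real j + 1) * h j (x - a j))"
      and h: "\<And>j. smooth_fun (h j)"
      and out: "\<And>j x. s j < norm (x - a j) \<Longrightarrow> g j x = 0"
      and C: "C \<ge> 0" "\<And>j x. norm x \<le> s j \<Longrightarrow> \<bar>iter_partial is (h j) x\<bar> \<le> C * s j"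
    for g h :: "nat \<Rightarrow> real ^ 'n \<Rightarrow> real" and "is" C
  proof (intro exI allI)
    fix j x
    show "\<bar>iter_partial is (g j) x\<bar> \<le> C * (norm x)\<^sup>2"
    proof (cases "norm (x - a j) \<le> s j")
      case True
      have "\<bar>iter_partial is (g j) x\<bar> = (real j + 1) * \<bar>iter_partial is (h j) (x - a j)\<bar>"
        unfolding g iter_partial_affine[OF h] by (simp add: abs_mult)
      also have "\<dots> \<le> (real j + 1) * (C * s j)"
        by (intro mult_left_mono C(2) True) simp
      also have "\<dots> = C * ((1 / 16) ^ j / 8)"
        unfolding s(4)[symmetric] by (simp only: mult_ac)
      also have "\<dots> \<le> C * (norm x)\<^sup>2"
        by (intro mult_left_mono near True C(1))
      finally show ?thesis .
    next
      case False
      \<comment> \<open>The strict inequality gives an open set, so that all derivatives vanish on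
        it; the bounding sphere belongs to the other case.\<close>
      have "open {x. s j < norm (x - a j)}"
        by (intro open_Collect_less continuous_intros)
      then have "iter_partial is (g j) x = iter_partial is (\<lambda>x. 0) x"
        by (rule iter_partial_cong_open) (use out False in auto)
      then show ?thesis
        using C(1) by simp
    qed
  qed
  show ?thesis
  proof (rule that[of a w])
    fix j
    show "norm (a j) = (1 / 4) ^ j"
      by (rule norm_a)
    show "smooth_fun (w j)"
      unfolding w_def[abs_def] by (rule smooth_fun_affine[OF v[OF s(1,3,1)]])
    show "smooth_fun (laplacian (w j))"
      unfolding lw by (rule smooth_fun_affine[OF lv[OF s(1,3,1)]])
    show "w j x = 0" if "norm (x - a j) \<ge> (1 / 4) ^ j / 8" for x
      using w_out[of j x] s(2)[of j] that by linarith
    show "iter_partial (replicate (k + 2) p) (w j) (a j) = (real j + 1) * fact (k + 2)"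
      unfolding w_def[abs_def] iter_partial_affine[OF v[OF s(1,3,1)]] diff_self v_top[OF s(1,3,1)] ..
  next
    fix "is" :: "'n list" assume "length is \<le> k + 1"
    then obtain C where C: "C \<ge> 0" "\<And>e r x. 0 < e \<Longrightarrow> e \<le> 1 \<Longrightarrow> 0 < r \<Longrightarrow> r \<le> 1 \<Longrightarrow>
      norm x \<le> r \<Longrightarrow> \<bar>iter_partial is (v e r) x\<bar> \<le> C * r"
      using v_bound[of "is"] by auto
    show "\<exists>C. \<forall>j x. \<bar>iter_partial is (w j) x\<bar> \<le> C * (norm x)\<^sup>2"
      by (rule bound[OF _ v[OF s(1,3,1)] w_out C(1) C(2)[OF s(1,3,1,3)]]) (auto simp: w_def)
  next
    fix "is" :: "'n list" assume "length is \<le> k"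
    then obtain C where C: "C \<ge> 0" "\<And>e r x. 0 < e \<Longrightarrow> e \<le> 1 \<Longrightarrow> 0 < r \<Longrightarrow> r \<le> 1 \<Longrightarrow>
      norm x \<le> r \<Longrightarrow> \<bar>iter_partial is (laplacian (v e r)) x\<bar> \<le> C * e"
      using lv_bound[of "is"] by auto
    have "laplacian (w j) x = 0" if "s j < norm (x - a j)" for j x
    proof -
      have "open {x. s j < norm (x - a j)}"
        by (intro open_Collect_less continuous_intros)
      then have "laplacian (w j) x = laplacian (\<lambda>x. 0) x"
        by (rule laplacian_cong_open) (use w_out that in auto)
      then show ?thesis
        by (simp add: laplacian_def)
    qed
    then show "\<exists>C. \<forall>j x. \<bar>iter_partial is (laplacian (w j)) x\<bar> \<le> C * (norm x)\<^sup>2"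
      by (rule bound[OF lw lv[OF s(1,3,1)] _ C(1) C(2)[OF s(1,3,1,3)]])
  qed
qed

section \<open>Assembling the counterexample\<close>

theorem theorem1p3:
  fixes k :: nat and \<phi> :: "real \<Rightarrow> real"
  assumes "CARD('n::finite) \<ge> 2"
    and "k > 0"
    and "C_k_pos (k + 2) \<phi>"
    and "filterlim \<phi> at_top at_top"
    and "\<forall>j\<in>{1..k+2}. ((deriv ^^ j) \<phi> \<longlongrightarrow> 0) at_top"
  shows "\<exists>u :: real ^ 'n \<Rightarrow> real.
           compactly_supported u \<and>
           (\<forall>x. times_differentiable_at (k + 2) u x) \<and>
           C_k k (laplacian u) \<and>
           unbounded_partials (k + 2) u \<and>
           \<not> C_k (k + 2) u"
proof -
  obtain A :: "'n set" where "card A = 2"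
    using obtain_subset_with_card_n[OF assms(1)] by blast
  then obtain p q :: 'n where "p \<noteq> q"
    by (auto simp: card_2_iff)
  then obtain a and w :: "nat \<Rightarrow> real ^ 'n \<Rightarrow> real" where
    norm_a: "\<And>j. norm (a j) = (1 / 4) ^ j"
    and w: "\<And>j. smooth_fun (w j)"
    and lw: "\<And>j. smooth_fun (laplacian (w j))"
    and w_out: "\<And>j x. norm (x - a j) \<ge> (1 / 4) ^ j / 8 \<Longrightarrow> w j x = 0"
    and w_top: "\<And>j. iter_partial (replicate (k + 2) p) (w j) (a j) = (real j + 1) * fact (k + 2)"
    and w_bound: "\<And>is. length is \<le> k + 1 \<Longrightarrow> \<exists>C. \<forall>j x. \<bar>iter_partial is (w j) x\<bar> \<le> C * (norm x)\<^sup>2"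
    and lw_bound: "\<And>is. length is \<le> k \<Longrightarrow>
      \<exists>C. \<forall>j x. \<bar>iter_partial is (laplacian (w j)) x\<bar> \<le> C * (norm x)\<^sup>2"
    by (rule scaled_bumps_exist[of p q k]) (rule that)
  \<comment> \<open>At every point at most one term is nonzero, so the series is a finite
    sum.\<close>
  define u where "u x = (\<Sum>j. w j x)" for x
  have pw: "0 < (1 / 4 :: real) ^ j" "(1 / 4 :: real) ^ j \<le> 1" for j
    by (auto simp: power_le_one)
  have supp: "7 / 8 * (1 / 4) ^ j \<le> norm x" "norm x \<le> 9 / 8 * (1 / 4) ^ j" if "w j x \<noteq> 0" for j x
  proof -
    have "norm (x - a j) < (1 / 4) ^ j / 8"
      using w_out[of j x] that by linarith
    moreover have "norm (a j) \<le> norm x + norm (x - a j)" "norm x \<le> norm (a j) + norm (x - a j)"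
      using norm_triangle_ineq4[of x "x - a j"] norm_triangle_ineq[of "a j" "x - a j"] by simp_all
    ultimately show "7 / 8 * (1 / 4) ^ j \<le> norm x" "norm x \<le> 9 / 8 * (1 / 4) ^ j"
      unfolding norm_a by linarith+
  qed
  \<comment> \<open>For i < j the j-th support has norms at most 9/32 of (1/4)^i and the i-th at
    least 7/8 of it. Their ratio exceeds 5/3, so no shell between 3/4 t and 5/4 t meets
    both.\<close>
  have disj: "\<not> i < j" if "w i z \<noteq> 0" "w j y \<noteq> 0" "norm z < 5 / 4 * t" "3 / 4 * t < norm y" for i j z y t
  proof
    assume "i < j"
    then have "(1 / 4 :: real) ^ j \<le> (1 / 4) ^ Suc i"
      by (intro power_decreasing) auto
    then show False
      using supp(1)[OF that(1)] supp(2)[OF that(2)] that(3,4) pw(1)[of i] by simp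
  qed
  have loc: "\<exists>j U. open U \<and> x \<in> U \<and> (\<forall>i y. i \<noteq> j \<longrightarrow> y \<in> U \<longrightarrow> w i y = 0)" if "x \<noteq> 0" for x
  proof -
    \<comment> \<open>The radius is chosen so that norms in \<open>U\<close> lie between 3/4 and 5/4
      of that of x.\<close>
    define U where "U = ball x (norm x / 4)"
    have U: "norm y < 5 / 4 * norm x" "3 / 4 * norm x < norm y" if "y \<in> U" for y
      using that norm_triangle_ineq2[of x y] norm_triangle_ineq2[of y x]
      by (auto simp: U_def dist_norm norm_minus_commute)
    have "\<exists>j. \<forall>i y. i \<noteq> j \<longrightarrow> y \<in> U \<longrightarrow> w i y = 0"
    proof (rule ccontr)
      assume neg: "\<not> ?thesis"
      then obtain j y where j: "y \<in> U" "w j y \<noteq> 0"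
        by blast
      from neg obtain i z where i: "i \<noteq> j" "z \<in> U" "w i z \<noteq> 0"
        by blast
      have "\<not> i < j" "\<not> j < i"
        using disj[OF i(3) j(2) U(1)[OF i(2)] U(2)[OF j(1)]]
          disj[OF j(2) i(3) U(1)[OF j(1)] U(2)[OF i(2)]] by auto
      with i(1) show False
        by simp
    qed
    moreover have "open U" "x \<in> U"
      using that by (auto simp: U_def)
    ultimately show ?thesis
      by blast
  qed
  have u_eq: "u y = w j y" if "\<And>i. i \<noteq> j \<Longrightarrow> w i y = 0" for j y
    unfolding u_def using suminf_finite[of "{j}" "\<lambda>j. w j y"] that by simp
  have u_loc: "\<exists>j U. open U \<and> x \<in> U \<and> (\<forall>y\<in>U. u y = w j y)" if "x \<noteq> 0" for x
    using loc[OF that] u_eq by meson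
  have "w j 0 = 0" for j
    using supp(1)[of j 0] pw(1)[of j] by auto
  then have u0: "u 0 = 0"
    by (simp add: u_def)
  have u_diff: "iter_partial is u differentiable (at x)" "iter_partial is u 0 = 0"
    if "length is \<le> k + 1" for "is" x
    by (rule iter_partial_differentiable_of_local[OF w u_loc u0 w_bound that]; assumption)+
  have l_loc: "\<exists>j U. open U \<and> x \<in> U \<and> (\<forall>y\<in>U. laplacian u y = laplacian (w j) y)" if "x \<noteq> 0" for x
    using u_loc[OF that] laplacian_cong_open by metis
  \<comment> \<open>Positivity of k enters here: the second derivatives are among those of order at
    most k + 1, which vanish at 0.\<close>
  have l0: "laplacian u 0 = 0"
    unfolding laplacian_def using assms(2) by (intro sum.neutral ballI u_diff(2)) auto
  have l_diff: "iter_partial is (laplacian u) differentiable (at x)" if "length is \<le> k" for "is" x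
    by (rule iter_partial_differentiable_of_local(1)[OF lw l_loc l0 lw_bound that])
  have "norm x \<le> 2" if "u x \<noteq> 0" for x
  proof -
    have "\<exists>j. w j x \<noteq> 0"
      using that u_eq[of 0 x] by metis
    then obtain j where "w j x \<noteq> 0"
      by blast
    then show ?thesis
      using supp(2)[of j x] pw(2)[of j] by linarith
  qed
  then have "compactly_supported u"
    unfolding compactly_supported_def compact_closure bounded_iff by blast
  moreover have "times_differentiable_at (k + 2) u x" for x
    unfolding times_differentiable_at_def partials_exist_on_def
    by (intro conjI exI[of _ UNIV])
       (simp_all add: u_diff(1) differentiable_imp_has_partial_at less_Suc_eq_le)
  moreover have "C_k k (laplacian u)"
    unfolding C_k_def partials_exist_on_def
    by (auto intro!: continuous_at_imp_continuous_on differentiable_imp_continuous_within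
        differentiable_imp_has_partial_at l_diff)
  moreover have top: "iter_partial (replicate (k + 2) p) u (a j) = (real j + 1) * fact (k + 2)" for j
  proof -
    have "a j \<noteq> 0"
      using norm_a[of j] pw(1)[of j] by auto
    then obtain i U where U: "open U" "a j \<in> U" "\<And>l y. l \<noteq> i \<Longrightarrow> y \<in> U \<Longrightarrow> w l y = 0"
      using loc by metis
    \<comment> \<open>If another bump were the active one near \<open>a j\<close>, then
      \<open>w j\<close> would vanish there, contradicting its nonzero derivative of top order at
      \<open>a j\<close>.\<close>
    have "i = j"
    proof (rule ccontr)
      assume "i \<noteq> j"
      then have "iter_partial (replicate (k + 2) p) (w j) (a j) = iter_partial (replicate (k + 2) p) (\<lambda>x. 0) (a j)"
        using U by (intro iter_partial_cong_open[of U]) auto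
      then show False
        by (simp only: w_top iter_partial_zero) (simp add: add_eq_0_iff)
    qed
    then have "iter_partial (replicate (k + 2) p) u (a j) = iter_partial (replicate (k + 2) p) (w j) (a j)"
      using U u_eq by (intro iter_partial_cong_open[of U]) auto
    then show ?thesis
      by (simp only: w_top)
  qed
  \<comment> \<open>Unboundedness already on a compact ball refutes the continuity of this
    derivative as well.\<close>
  have unbdd: "\<not> bounded (iter_partial (replicate (k + 2) p) u ` cball 0 1)"
  proof
    assume "bounded (iter_partial (replicate (k + 2) p) u ` cball 0 1)"
    then obtain B where B: "\<forall>x\<in>cball 0 1. \<bar>iter_partial (replicate (k + 2) p) u x\<bar> \<le> B"
      unfolding bounded_iff by auto
    obtain j where "B < real j"
      using reals_Archimedean2 by blast
    moreover have "real j + 1 \<le> \<bar>(real j + 1) * fact (k + 2)\<bar>"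
      using mult_left_mono[OF fact_ge_1[of "k + 2"], of "real j + 1"] by (simp add: abs_mult)
    moreover have "a j \<in> cball 0 1"
      using norm_a[of j] pw(2)[of j] by simp
    then have "\<bar>(real j + 1) * fact (k + 2)\<bar> \<le> B"
      using B unfolding top[symmetric] by blast
    ultimately show False
      by linarith
  qed
  then have "unbounded_partials (k + 2) u"
    unfolding unbounded_partials_def
    by (intro exI[of _ "replicate (k + 2) p"]) (meson bounded_subset image_mono length_replicate top_greatest)
  moreover have "\<not> C_k (k + 2) u"
  proof
    assume "C_k (k + 2) u"
    then have "continuous_on UNIV (iter_partial (replicate (k + 2) p) u)"
      by (simp add: C_k_def del: replicate.simps)
    then show False
      using unbdd by (meson compact_cball compact_continuous_image compact_imp_bounded
          continuous_on_subset top_greatest)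
  qed
  ultimately show ?thesis
    by blast
qed

end
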